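(* Let $p$ be a prime and $\mathcal{K}$ a complete non-Archimedean field of characteristic $p$. Let $\lambda\in\mathcal{K}$ be not a root of unity and satisfy $|1-\lambda|<1$. Then for every integer $n\ge 1$ and every $a_n\in\mathcal{K}$, the polynomial $\lambda z+a_nz^{n+1}\in\mathcal{K}[z]$ is linearizable if and only if either $p\mid n+1$ or $a_n=0$.
   Context: A power series $f(z)=z(\lambda+\sum_{i\ge1}a_iz^i)\in\mathcal{K}[[z]]$ that is locally analytic at $z=0$ (positive radius of convergence) is called (locally) linearizable at $z=0$ if there is a locally analytic (at $z=0$) power series $h(z)=b_0z+b_1z^2+\cdots\in\mathcal{K}[[z]]$ with $b_0\neq0$ such that $h\circ f\circ h^{-1}(z)=\lambda z$. *)

theory Defs
  imports
    "HOL-Analysis.Analysis"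
    "HOL-Computational_Algebra.Computational_Algebra"
begin

text \<open>
  The absolute value is an explicit function \<open>v\<close> rather than a \<open>norm\<close>, because the
  type class \<^class>\<open>real_normed_field\<close> forces characteristic zero. The trivial absolute value
  is not excluded.
\<close>

locale complete_nonarch_field =
  fixes v :: "'a::field \<Rightarrow> real"
  assumes v_nonneg: "0 \<le> v x"
    and v_eq_0_iff: "v x = 0 \<longleftrightarrow> x = 0"
    and v_mult: "v (x * y) = v x * v y"
    and v_ultrametric: "v (x + y) \<le> max (v x) (v y)"
    and v_complete: "Metric_space.mcomplete UNIV (\<lambda>x y. v (x - y))"
begin

lemma v_1: "v 1 = 1"
  using v_mult[of 1 1] v_eq_0_iff[of 1] by simp

lemma v_minus: "v (- x) = v x"
proof -
  have "v (- 1) * v (- 1) = 1"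
    using v_mult[of "- 1" "- 1"] v_1 by simp
  then have "v (- 1) = 1"
    using v_nonneg[of "- 1"] by (simp add: square_eq_1_iff)
  then show ?thesis
    using v_mult[of "- 1" x] by simp
qed

text \<open>
  This interpretation shows that \<^const>\<open>Metric_space.mcomplete\<close> in the last assumption is
  applied to a genuine metric, so that it has its intended meaning.
\<close>

sublocale Metric_space UNIV "\<lambda>x y. v (x - y)"
proof
  fix x y z :: 'a
  show "0 \<le> v (x - y)" by (rule v_nonneg)
  show "v (x - y) = v (y - x)" using v_minus[of "x - y"] by simp
  show "v (x - y) = 0 \<longleftrightarrow> x = y" by (simp add: v_eq_0_iff)
  have "v (x - z) \<le> max (v (x - y)) (v (y - z))"
    using v_ultrametric[of "x - y" "y - z"] by simp
  also have "\<dots> \<le> v (x - y) + v (y - z)"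
    using v_nonneg[of "x - y"] v_nonneg[of "y - z"] by simp
  finally show "v (x - z) \<le> v (x - y) + v (y - z)" .
qed

end

text \<open>
  The radius of convergence at the origin is \<open>1 / limsup \<bar>c\<^sub>k\<bar>\<^sup>1\<^sup>/\<^sup>k\<close>; it is obtained by applying
  \<^const>\<open>conv_radius\<close> to the real sequence of absolute values of the coefficients.
\<close>

definition locally_analytic :: "('a::field \<Rightarrow> real) \<Rightarrow> 'a fps \<Rightarrow> bool" where
  "locally_analytic v f \<longleftrightarrow> conv_radius (\<lambda>k. v (fps_nth f k)) > 0"

text \<open>
  Here \<open>\<lambda>\<close> is the linear coefficient of \<open>f\<close>. The operation \<^const>\<open>fps_inv\<close> is the
  inverse under composition.
\<close>

definition linearizable :: "('a::field \<Rightarrow> real) \<Rightarrow> 'a fps \<Rightarrow> bool" where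
  "linearizable v f \<longleftrightarrow>
     fps_nth f 0 = 0 \<and> locally_analytic v f \<and>
     (\<exists>h. fps_nth h 0 = 0 \<and> fps_nth h 1 \<noteq> 0 \<and> locally_analytic v h \<and>
          fps_compose (fps_compose h f) (fps_inv h) = fps_const (fps_nth f 1) * fps_X)"

end

theory Submission
  imports Defs
begin

text \<open>
  A linearization is a series \<open>h\<close> with \<open>h \<circ> f = \<lambda>h\<close>, and its coefficients are determined by a recurrence
  with the divisors \<open>\<lambda> - \<lambda>\<^sup>m\<close>. Since \<open>\<bar>1 - \<lambda>\<bar> < 1\<close> and the characteristic is \<open>p\<close>, the absolute value of
  \<open>1 - \<lambda>\<^sup>m\<close> is \<open>\<bar>1 - \<lambda>\<bar>\<close> raised to the largest power of \<open>p\<close> dividing \<open>m\<close>.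

  If \<open>p\<close> divides \<open>n + 1\<close>, then \<open>f\<close> has constant derivative, hence every exponent of \<open>h\<close> other than \<open>1\<close>
  is divisible by \<open>p\<close>. Only divisors of absolute value \<open>\<bar>1 - \<lambda>\<bar>\<close> occur and \<open>h\<close> converges.

  Otherwise normalize \<open>h\<close> so that \<open>h = \<Sum>\<^sub>k b\<^sub>k a\<^sup>k z\<^sup>k\<^sup>n\<^sup>+\<^sup>1\<close> with \<open>b\<^sub>0 = 1\<close>. Unfolding the recurrence
  expresses \<open>b\<^sub>k\<close> as a sum over increasing paths from \<open>0\<close> to \<open>k\<close>, a path being weighted by binomial
  coefficients and by the inverses of \<open>1 - \<lambda>\<^sup>j\<^sup>n\<close> over the vertices \<open>j\<close> that it visits. There is a unique
  dominant path: it visits all \<open>j\<close> except those with \<open>p dvd j * n + 1\<close>, from which every short step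
  has binomial coefficient \<open>0\<close>. This gives \<open>\<bar>b\<^sub>k\<bar>\<close> exactly, and the multiples of \<open>p\<close> alone make it grow
  like \<open>\<bar>1 - \<lambda>\<bar>\<close> to the power \<open>- c k log k\<close>.
\<close>

section \<open>Linearization as a semiconjugacy, an equation linear in \<open>h\<close>; powers of a
  binomial\<close>

lemma linearizable_iff_semiconjugacy:
  fixes f :: "'a::field fps"
  assumes "fps_nth f 0 = 0" "locally_analytic v f"
  shows "linearizable v f \<longleftrightarrow>
    (\<exists>h. fps_nth h 0 = 0 \<and> fps_nth h 1 \<noteq> 0 \<and> locally_analytic v h \<and>
         h oo f = fps_const (fps_nth f 1) * h)"
proof -
  have "(h oo f) oo fps_inv h = fps_const (fps_nth f 1) * fps_X \<longleftrightarrow>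
        h oo f = fps_const (fps_nth f 1) * h"
    if h: "fps_nth h 0 = 0" "fps_nth h 1 \<noteq> 0" for h
  proof
    assume "(h oo f) oo fps_inv h = fps_const (fps_nth f 1) * fps_X"
    then have "((h oo f) oo fps_inv h) oo h = (fps_const (fps_nth f 1) * fps_X) oo h"
      by simp
    moreover have "((h oo f) oo fps_inv h) oo h = h oo f"
    proof -
      have "fps_nth (fps_inv h) 0 = 0"
        by (simp add: fps_inv_def)
      then show ?thesis
        using h by (simp add: fps_compose_assoc[symmetric] fps_inv)
    qed
    ultimately show "h oo f = fps_const (fps_nth f 1) * h"
      using h by (simp add: fps_compose_mult_distrib)
  next
    assume "h oo f = fps_const (fps_nth f 1) * h"
    moreover have "fps_nth (fps_inv h) 0 = 0"
      by (simp add: fps_inv_def)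
    ultimately show "(h oo f) oo fps_inv h = fps_const (fps_nth f 1) * fps_X"
      using h by (simp add: fps_compose_mult_distrib fps_inv_right)
  qed
  then show ?thesis
    using assms unfolding linearizable_def by blast
qed

lemma fps_nth_binomial_power:
  fixes lam a :: "'a::field"
  assumes "n \<ge> 1"
  shows "fps_nth (fps_of_poly (monom lam 1 + monom a (n + 1)) ^ i) m =
    (\<Sum>j\<le>i. if m = i + j * n then of_nat (i choose j) * lam ^ (i - j) * a ^ j else 0)"
proof -
  have "fps_of_poly (monom lam 1 + monom a (n + 1)) ^ i =
    (fps_const a * fps_X ^ (n + 1) + fps_const lam * fps_X) ^ i"
    by (simp add: fps_of_poly_simps add.commute)
  also have "\<dots> = (\<Sum>j\<le>i. of_nat (i choose j) * (fps_const a * fps_X ^ (n + 1)) ^ j * (fps_const lam * fps_X) ^ (i - j))"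
    by (rule binomial_ring)
  also have "\<dots> = (\<Sum>j\<le>i. fps_const (of_nat (i choose j) * lam ^ (i - j) * a ^ j) * fps_X ^ (i + j * n))"
  proof (rule sum.cong[OF refl])
    fix j assume j: "j \<in> {..i}"
    then have "(n + 1) * j + (i - j) = i + j * n"
      by (simp add: algebra_simps)
    then have "fps_X ^ (i + j * n) = (fps_X ^ (n + 1)) ^ j * (fps_X ^ (i - j) :: 'a fps)"
      by (metis power_add power_mult)
    then show "of_nat (i choose j) * (fps_const a * fps_X ^ (n + 1)) ^ j * (fps_const lam * fps_X) ^ (i - j) =
       fps_const (of_nat (i choose j) * lam ^ (i - j) * a ^ j) * fps_X ^ (i + j * n)"
      by (simp add: power_mult_distrib fps_const_power fps_of_nat[symmetric]
          fps_const_mult[symmetric] mult_ac del: fps_const_mult)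
  qed
  finally show ?thesis
    by (simp add: fps_sum_nth if_distrib cong: if_cong)
qed

section \<open>Ultrametric estimates, the divisors 1 - x^m, and local analyticity\<close>

context complete_nonarch_field
begin

lemma v_0: "v 0 = 0"
  by (simp add: v_eq_0_iff)

lemma v_pos_iff: "0 < v x \<longleftrightarrow> x \<noteq> 0"
  using v_nonneg[of x] v_eq_0_iff[of x] by linarith

lemma v_power: "v (x ^ n) = v x ^ n"
  by (induction n) (simp_all add: v_1 v_mult)

lemma v_divide: "v (x / y) = v x / v y"
proof (cases "y = 0")
  case False
  then have "v (x / y) * v y = v x"
    by (simp flip: v_mult)
  with False show ?thesis
    by (simp add: v_eq_0_iff field_simps)
qed (simp add: v_0)

lemma v_sum_le:
  assumes "\<And>i. i \<in> A \<Longrightarrow> v (f i) \<le> B" "0 \<le> B"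
  shows "v (sum f A) \<le> B"
  using assms
proof (induction A rule: infinite_finite_induct)
  case (insert i A)
  then show ?case
    using v_ultrametric[of "f i" "sum f A"] by (simp add: order_trans)
qed (simp_all add: v_0)

lemma v_add_eq:
  assumes "v y < v x"
  shows "v (x + y) = v x"
proof (rule antisym)
  show "v (x + y) \<le> v x"
    using v_ultrametric[of x y] assms by simp
  show "v x \<le> v (x + y)"
    using v_ultrametric[of "x + y" "- y"] assms by (simp add: v_minus)
qed

lemma v_sum_eq:
  assumes "finite A" "k \<in> A" "f k \<noteq> 0" "\<And>i. i \<in> A \<Longrightarrow> i \<noteq> k \<Longrightarrow> v (f i) < v (f k)"
  shows "v (sum f A) = v (f k)"
proof (cases "A - {k} = {}")
  case True
  then have "A = {k}"
    using assms(2) by auto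
  then show ?thesis
    by simp
next
  case False
  define B where "B = Max ((\<lambda>i. v (f i)) ` (A - {k}))"
  have "B < v (f k)"
    using False assms by (auto simp: B_def)
  moreover have "v (sum f (A - {k})) \<le> B"
  proof (rule v_sum_le)
    show "v (f i) \<le> B" if "i \<in> A - {k}" for i
      unfolding B_def using that assms(1) by (intro Max_ge) auto
    with False show "0 \<le> B"
      using v_nonneg order_trans by blast
  qed
  ultimately show ?thesis
    using v_add_eq[of "sum f (A - {k})" "f k"] assms(1,2) by (simp add: sum.remove)
qed

lemma v_of_nat_le: "v (of_nat m) \<le> 1"
proof (induction m)
  case (Suc m)
  then show ?case
    using v_ultrametric[of 1 "of_nat m"] by (simp add: v_1)
qed (simp add: v_0)

text \<open>An inverse of \<open>m\<close> modulo the characteristic is again a natural number. So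
  two values at most 1 have product 1, and both equal 1.\<close>

lemma v_of_nat_eq_1:
  assumes "prime CHAR('a)" "\<not> CHAR('a) dvd m"
  shows "v (of_nat m) = 1"
proof -
  have "coprime m CHAR('a)"
    using assms by (metis coprime_commute prime_imp_coprime)
  then obtain x y where "m * x = 1 + CHAR('a) * y"
    using assms by (metis bezout_nat coprime_imp_gcd_eq_1 prime_gt_0_nat dvd_0_right mult.commute gcd.commute add.commute)
  then have "of_nat m * of_nat x = (of_nat (1 + CHAR('a) * y) :: 'a)"
    by (metis of_nat_mult)
  then have "v (of_nat m) * v (of_nat x) = 1"
    by (simp add: v_1 flip: v_mult)
  then show ?thesis
    using v_of_nat_le[of m] v_of_nat_le[of x] v_nonneg[of "of_nat m"]
    by (metis antisym mult.right_neutral mult_left_mono)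
qed

lemma v_eq_1_if_near_1:
  assumes "v (1 - x) < 1"
  shows "v x = 1"
  using v_add_eq[of "x - 1" 1] v_minus[of "1 - x"] assms by (simp add: v_1)

lemma v_one_minus_power_le:
  assumes "v (1 - x) < 1"
  shows "v (1 - x ^ m) \<le> v (1 - x)"
proof -
  have "v (\<Sum>i<m. x ^ i) \<le> 1"
    by (rule v_sum_le) (simp_all add: v_power v_eq_1_if_near_1[OF assms])
  then show ?thesis
    by (simp add: one_diff_power_eq v_mult mult_left_le v_nonneg)
qed

text \<open>The cofactor 1 + x + ... + x^(m-1) differs from \<open>m\<close> by something of
  absolute value at most |1 - x| < 1, and \<open>m\<close> has absolute value 1.\<close>

lemma v_one_minus_power_eq:
  assumes "prime CHAR('a)" "\<not> CHAR('a) dvd m" "v (1 - x) < 1"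
  shows "v (1 - x ^ m) = v (1 - x)"
proof -
  have "v (\<Sum>i<m. x ^ i - 1) \<le> v (1 - x)"
  proof (rule v_sum_le)
    show "v (x ^ i - 1) \<le> v (1 - x)" for i
      using v_one_minus_power_le[OF assms(3), of i] v_minus[of "1 - x ^ i"] by simp
  qed (rule v_nonneg)
  then have "v ((\<Sum>i<m. x ^ i) - of_nat m) < v (of_nat m)"
    using assms by (simp add: v_of_nat_eq_1 sum_subtractf)
  from v_add_eq[OF this] have "v (\<Sum>i<m. x ^ i) = 1"
    using assms by (simp add: v_of_nat_eq_1)
  then show ?thesis
    by (simp add: one_diff_power_eq v_mult)
qed

lemma v_one_minus_power_CHAR:
  assumes "prime CHAR('a)"
  shows "v (1 - x ^ CHAR('a)) = v (1 - x) ^ CHAR('a)"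
proof -
  have "(1 - x + x) ^ CHAR('a) = (1 - x) ^ CHAR('a) + x ^ CHAR('a)"
    by (rule freshmans_dream[OF assms refl])
  then have "1 - x ^ CHAR('a) = (1 - x) ^ CHAR('a)"
    by (simp add: algebra_simps)
  then show ?thesis
    by (simp add: v_power)
qed

text \<open>Both constants are taken at least 1 so that their powers increase with the exponent and
  can be absorbed into one another.\<close>

lemma locally_analytic_iff:
  "locally_analytic v f \<longleftrightarrow> (\<exists>C R. C \<ge> 1 \<and> R \<ge> 1 \<and> (\<forall>k. v (fps_nth f k) \<le> C * R ^ k))"
proof
  assume "locally_analytic v f"
  then obtain r where r: "0 < ereal r" "ereal r < conv_radius (\<lambda>k. v (fps_nth f k))"
    unfolding locally_analytic_def using ereal_dense2 by blast
  then have "summable (\<lambda>k. v (fps_nth f k) * r ^ k)"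
    by (intro summable_in_conv_radius) simp
  then obtain C where C: "\<And>k. norm (v (fps_nth f k) * r ^ k) \<le> C"
    using summable_imp_Bseq BseqE by blast
  have "v (fps_nth f k) \<le> max C 1 * max (1 / r) 1 ^ k" for k
  proof -
    have "v (fps_nth f k) = v (fps_nth f k) * r ^ k * (1 / r) ^ k"
      using r by (simp add: power_divide)
    also have "\<dots> \<le> max C 1 * max (1 / r) 1 ^ k"
      using C[of k] r by (intro mult_mono power_mono) (auto simp: v_nonneg)
    finally show ?thesis .
  qed
  then show "\<exists>C R. C \<ge> 1 \<and> R \<ge> 1 \<and> (\<forall>k. v (fps_nth f k) \<le> C * R ^ k)"
    by (meson max.cobounded2)
next
  assume "\<exists>C R. C \<ge> 1 \<and> R \<ge> 1 \<and> (\<forall>k. v (fps_nth f k) \<le> C * R ^ k)"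
  then obtain C R :: real where CR: "C \<ge> 1" "R \<ge> 1" "\<And>k. v (fps_nth f k) \<le> C * R ^ k"
    by blast
  have "summable (\<lambda>k. v (fps_nth f k) * (1 / (2 * R)) ^ k)"
  proof (rule summable_comparison_test')
    show "summable (\<lambda>k. C * (1 / 2 :: real) ^ k)"
      by (intro summable_mult summable_geometric) simp
    show "norm (v (fps_nth f k) * (1 / (2 * R)) ^ k) \<le> C * (1 / 2) ^ k" for k
      using CR by (simp add: v_nonneg power_divide power_mult_distrib field_simps abs_mult)
  qed
  from conv_radius_geI[OF this] show "locally_analytic v f"
    using CR(2) unfolding locally_analytic_def
    by (intro less_le_trans[OF _ conv_radius_geI[OF \<open>summable _\<close>]]) simp
qed


text \<open>A product of \<open>i\<close> coefficients whose indices add up to \<open>m\<close> has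
  total excess over 1 equal to \<open>m - i\<close>, and the ultrametric inequality charges nothing
  for the number of such products.\<close>

lemma v_power_nth_le:
  assumes "fps_nth f 0 = 0" "A \<ge> 1" "\<And>m. m \<ge> 1 \<Longrightarrow> v (fps_nth f m) \<le> A ^ (m - 1)"
  shows "v (fps_nth (f ^ i) m) \<le> A ^ (m - i)"
proof (induction i arbitrary: m)
  case 0
  then show ?case
    using assms(2) by (simp add: v_0 v_1)
next
  case (Suc i)
  have "v (\<Sum>j=0..m. fps_nth f j * fps_nth (f ^ i) (m - j)) \<le> A ^ (m - Suc i)"
  proof (rule v_sum_le)
    fix j assume j: "j \<in> {0..m}"
    show "v (fps_nth f j * fps_nth (f ^ i) (m - j)) \<le> A ^ (m - Suc i)"
    proof (cases "j = 0 \<or> m - j < i")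
      case True
      then have "fps_nth f j * fps_nth (f ^ i) (m - j) = 0"
        using assms(1) startsby_zero_power_prefix[OF assms(1), of i] by auto
      then show ?thesis
        using assms(2) by (auto simp: v_0)
    next
      case False
      have "v (fps_nth f j * fps_nth (f ^ i) (m - j)) \<le> A ^ (j - 1) * A ^ (m - j - i)"
        unfolding v_mult using False assms(2)
        by (intro mult_mono assms(3) Suc.IH) (auto simp: v_nonneg)
      also have "\<dots> = A ^ (m - Suc i)"
      proof -
        have "j - 1 + (m - j - i) = m - Suc i"
          using False j by auto
        then show ?thesis
          by (metis power_add)
      qed
      finally show ?thesis .
    qed
  qed (use assms(2) in simp)
  then show ?case
    by (simp add: fps_mult_nth)
qed

end

section \<open>The linearizable case: convergence of the formal linearization\<close>

lemma CHAR_dvd_if_power_nth_nonzero: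
  fixes f :: "'a::field fps"
  assumes "CHAR('a) dvd i" "fps_nth (f ^ i) m \<noteq> 0"
  shows "CHAR('a) dvd m"
proof (cases m)
  case (Suc k)
  \<comment> \<open>The exponent is zero in the field, so \<open>f ^ i\<close> has derivative
    zero.\<close>
  have "of_nat i = (0 :: 'a)"
    using assms(1) by (simp add: of_nat_eq_0_iff_char_dvd)
  then have "fps_deriv (f ^ i) = 0"
    by (simp add: fps_deriv_power)
  then have "of_nat m * fps_nth (f ^ i) m = 0"
    using Suc by (metis fps_deriv_nth fps_zero_nth Suc_eq_plus1)
  then show ?thesis
    using assms(2) by (simp add: of_nat_eq_0_iff_char_dvd)
qed simp

text \<open>Obtained by comparing coefficients of z^m in h o f = \<lambda>h, with linear coefficient
  of h equal to 1; the term \<open>i = m\<close> contributes \<lambda>^m and has been moved to the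
  denominator.\<close>

fun linearization_coeff :: "'a::field fps \<Rightarrow> nat \<Rightarrow> 'a" where
  "linearization_coeff f m =
    (if m = 0 then 0 else if m = 1 then 1
     else (\<Sum>i<m. linearization_coeff f i * fps_nth (f ^ i) m) / (fps_nth f 1 - fps_nth f 1 ^ m))"

declare linearization_coeff.simps [simp del]

lemma linearization_coeff_0 [simp]: "linearization_coeff f 0 = 0"
  and linearization_coeff_1 [simp]: "linearization_coeff f (Suc 0) = 1"
  by (simp_all add: linearization_coeff.simps)

lemma formal_linearization:
  fixes f :: "'a::field fps"
  assumes f0: "fps_nth f 0 = 0" and f1: "fps_nth f 1 \<noteq> 0" "\<forall>k\<ge>1. fps_nth f 1 ^ k \<noteq> 1"
  shows "Abs_fps (linearization_coeff f) oo f = fps_const (fps_nth f 1) * Abs_fps (linearization_coeff f)"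
proof (rule fps_ext)
  fix m
  let ?h = "linearization_coeff f" and ?lam = "fps_nth f 1"
  show "fps_nth (Abs_fps ?h oo f) m = fps_nth (fps_const ?lam * Abs_fps ?h) m"
  proof (cases "m \<ge> 2")
    case True
    then have "?lam ^ (m - 1) \<noteq> 1"
      using f1(2) by simp
    moreover have "?lam ^ m = ?lam * ?lam ^ (m - 1)"
      using True by (simp flip: power_Suc)
    ultimately have "?lam - ?lam ^ m \<noteq> 0"
      using f1(1) by auto
    moreover have "?h m = (\<Sum>i<m. ?h i * fps_nth (f ^ i) m) / (?lam - ?lam ^ m)"
      using True by (subst linearization_coeff.simps) simp
    ultimately have "(\<Sum>i<m. ?h i * fps_nth (f ^ i) m) = ?h m * (?lam - ?lam ^ m)"
      by simp
    moreover have "{0..m} = insert m {..<m}"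
      by auto
    ultimately show ?thesis
      using startsby_zero_power_nth_same[OF f0, of m]
      by (simp add: fps_compose_nth algebra_simps)
  next
    case False
    then have "m = 0 \<or> m = Suc 0"
      by auto
    then show ?thesis
      by (auto simp: fps_compose_nth)
  qed
qed

context complete_nonarch_field
begin

text \<open>
  All exponents other than \<open>1\<close> are divisible by the characteristic, so the formal linearization
  only involves the divisors \<open>\<lambda> - \<lambda>\<^sup>m\<close> with \<open>m - 1\<close> prime to the characteristic, and these all have
  the same absolute value as \<open>1 - \<lambda>\<close>.
\<close>

lemma linearizable_if_CHAR_dvd_exponents:
  fixes f :: "'a fps"
  assumes p: "prime CHAR('a)"
    and f0: "fps_nth f 0 = 0"
    and analytic: "locally_analytic v f"
    and near: "v (1 - fps_nth f 1) < 1"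
    and nonroot: "\<forall>k\<ge>1. fps_nth f 1 ^ k \<noteq> 1"
    and exponents: "\<And>m. fps_nth f m \<noteq> 0 \<Longrightarrow> m = 1 \<or> CHAR('a) dvd m"
  shows "linearizable v f"
proof -
  let ?h = "linearization_coeff f" and ?lam = "fps_nth f 1"
  define d where "d = v (1 - ?lam)"
  have v_lam: "v ?lam = 1"
    using near by (rule v_eq_1_if_near_1)
  have d: "0 < d" "d < 1"
    using nonroot[rule_format, of 1] near by (auto simp: d_def v_pos_iff)
  obtain C R where CR: "C \<ge> 1" "R \<ge> 1" "\<And>k. v (fps_nth f k) \<le> C * R ^ k"
    using analytic by (auto simp: locally_analytic_iff)
  \<comment> \<open>For m >= 2 both \<open>m\<close> <= 2(m - 1) and 1 <= m - 1 hold, so this choice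
    absorbs \<open>C\<close> and the shift of the exponent.\<close>
  define A where "A = C * R ^ 2"
  have A: "A \<ge> 1"
    using CR(1,2) mult_mono[of 1 C 1 "R ^ 2"] by (simp add: A_def)
  have f_le: "v (fps_nth f m) \<le> A ^ (m - 1)" if "m \<ge> 1" for m
  proof (cases "m = 1")
    case False
    have "C \<le> C ^ (m - 1)"
      using False that CR(1) power_increasing[of 1 "m - 1" C] by simp
    moreover have "R ^ m \<le> R ^ (2 * (m - 1))"
      using False that CR(2) by (intro power_increasing) auto
    ultimately have "C * R ^ m \<le> C ^ (m - 1) * R ^ (2 * (m - 1))"
      using CR(1,2) by (intro mult_mono) auto
    also have "\<dots> = A ^ (m - 1)"
      by (simp add: A_def power_mult_distrib power_mult)
    finally show ?thesis
      using CR(3)[of m] by simp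
  qed (use v_lam in simp)
  \<comment> \<open>A nonzero coefficient at \<open>m\<close> comes from some earlier
    \<open>i\<close> in the support: \<open>i = 1\<close> gives an exponent of \<open>f\<close>
    itself, and any other \<open>i\<close> is divisible by the characteristic, as are then all
    exponents in \<open>f ^ i\<close>.\<close>
  have support: "m = 1 \<or> CHAR('a) dvd m" if "?h m \<noteq> 0" for m
    using that
  proof (induction m rule: less_induct)
    case (less m)
    show ?case
    proof (cases "m = 0 \<or> m = 1")
      case False
      then have "(\<Sum>i<m. ?h i * fps_nth (f ^ i) m) \<noteq> 0"
        using less.prems by (subst (asm) linearization_coeff.simps) auto
      then obtain i where i: "i < m" "?h i \<noteq> 0" "fps_nth (f ^ i) m \<noteq> 0"
        by (metis (no_types, lifting) lessThan_iff mult_eq_0_iff sum.neutral)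
      then consider "i = 1" | "CHAR('a) dvd i"
        using less.IH by blast
      then show ?thesis
      proof cases
        case 1
        then show ?thesis
          using i exponents[of m] by simp
      next
        case 2
        then show ?thesis
          using i CHAR_dvd_if_power_nth_nonzero by blast
      qed
    qed auto
  qed
  have q: "A \<le> A / d" "1 \<le> A / d"
    using A d by (simp_all add: field_simps mult_left_le)
  have bound: "v (?h m) \<le> (A / d) ^ (m - 1)" for m
  proof (induction m rule: less_induct)
    case (less m)
    show ?case
    proof (cases "?h m = 0 \<or> m = 1")
      case True
      then show ?thesis
        using q by (auto simp: v_0 v_1)
    next
      case False
      then have dvd: "CHAR('a) dvd m" and m: "m \<ge> 2"
        using support[of m] by (auto intro: ccontr simp: not_le less_2_cases_iff)
      then have "\<not> CHAR('a) dvd m - 1"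
        using p by (metis dvd_diffD1 not_prime_unit nat_le_linear One_nat_def diff_is_0_eq' diff_diff_cancel dvd_diff_nat numeral_2_eq_2 Suc_leD)
      then have "v (1 - ?lam ^ (m - 1)) = d"
        using p near by (simp add: v_one_minus_power_eq d_def)
      moreover have "?lam - ?lam ^ m = ?lam * (1 - ?lam ^ (m - 1))"
        using m by (simp add: algebra_simps flip: power_Suc)
      ultimately have div: "v (?lam - ?lam ^ m) = d"
        using v_lam by (simp add: v_mult)
      \<comment> \<open>Since \<open>i < m\<close>, one factor \<open>A\<close> can be kept apart;
        dividing by the divisor, of absolute value \<open>d\<close>, turns it into the missing
        factor \<open>A / d\<close>.\<close>
      have "v (\<Sum>i<m. ?h i * fps_nth (f ^ i) m) \<le> (A / d) ^ (m - 2) * A"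
      proof (rule v_sum_le)
        fix i assume i: "i \<in> {..<m}"
        show "v (?h i * fps_nth (f ^ i) m) \<le> (A / d) ^ (m - 2) * A"
        proof (cases "i = 0")
          case False
          have "v (?h i * fps_nth (f ^ i) m) \<le> (A / d) ^ (i - 1) * A ^ (m - i)"
            unfolding v_mult using less.IH[of i] i v_power_nth_le[OF f0 A f_le, of i m] q
            by (intro mult_mono) (auto simp: v_nonneg)
          also have "A ^ (m - i) = A ^ (m - 1 - i) * A"
            using i by (simp add: Suc_diff_Suc flip: power_Suc2)
          also have "(A / d) ^ (i - 1) * (A ^ (m - 1 - i) * A)
              \<le> (A / d) ^ (i - 1) * ((A / d) ^ (m - 1 - i) * A)"
            using q A by (intro mult_left_mono mult_right_mono power_mono) auto
          also have "\<dots> = (A / d) ^ (m - 2) * A"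
            using i False by (simp add: mult.assoc[symmetric] flip: power_add)
          finally show ?thesis .
        qed (use q A in \<open>simp add: v_0\<close>)
      qed (use q A in simp)
      moreover have "?h m = (\<Sum>i<m. ?h i * fps_nth (f ^ i) m) / (?lam - ?lam ^ m)"
        using m by (subst linearization_coeff.simps) simp
      ultimately have "v (?h m) \<le> (A / d) ^ (m - 2) * A / d"
        using d by (simp only: v_divide div divide_right_mono less_imp_le)
      also have "\<dots> = (A / d) ^ Suc (m - 2)"
        by simp
      also have "Suc (m - 2) = m - 1"
        using m by simp
      finally show ?thesis .
    qed
  qed
  have "locally_analytic v (Abs_fps ?h)"
    unfolding locally_analytic_iff
  proof (rule exI[of _ 1], rule exI[of _ "A / d"], intro conjI allI)
    show "v (fps_nth (Abs_fps ?h) k) \<le> 1 * (A / d) ^ k" for k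
      using bound[of k] power_increasing[of "k - 1" k "A / d"] q by simp
  qed (use q in simp_all)
  moreover have "?lam \<noteq> 0"
    using v_lam v_0 by auto
  ultimately show ?thesis
    using formal_linearization[OF f0 _ nonroot] f0 analytic
    by (subst linearizable_iff_semiconjugacy) (auto intro!: exI[of _ "Abs_fps ?h"])
qed

end

section \<open>The recurrence along the exponents kn + 1 and its binomial coefficients modulo
  p\<close>

lemma fps_nth_binomial_power_progression:
  fixes lam a :: "'a::field"
  assumes "n \<ge> 1" "l \<le> k"
  shows "fps_nth (fps_of_poly (monom lam 1 + monom a (n + 1)) ^ (l * n + 1)) (k * n + 1) =
    of_nat ((l * n + 1) choose (k - l)) * lam ^ (l * n + 1 - (k - l)) * a ^ (k - l)"
    (is "_ = ?g (k - l)")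
proof -
  have "k * n + 1 = l * n + 1 + j * n \<longleftrightarrow> j = k - l" for j
  proof -
    have "k * n + 1 = l * n + 1 + j * n \<longleftrightarrow> k * n = (l + j) * n"
      by (simp add: algebra_simps)
    then show ?thesis
      using assms by (auto simp del: add_mult_distrib)
  qed
  then have "fps_nth (fps_of_poly (monom lam 1 + monom a (n + 1)) ^ (l * n + 1)) (k * n + 1) =
      (\<Sum>j\<le>l * n + 1. if j = k - l then ?g j else 0)"
    unfolding fps_nth_binomial_power[OF assms(1)] by (intro sum.cong) auto
  \<comment> \<open>Beyond the range of summation the binomial coefficient vanishes, so the formula
    also covers steps that are too long, where the exponent of \<open>lam\<close> is
    truncated.\<close>
  also have "\<dots> = (if k - l \<le> l * n + 1 then ?g (k - l) else 0)"
    by simp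
  also have "\<dots> = ?g (k - l)"
    by (simp add: not_le binomial_eq_0)
  finally show ?thesis .
qed

lemma semiconjugacy_coeff_recurrence:
  fixes lam a :: "'a::field"
  assumes n: "n \<ge> 1" and h0: "fps_nth h 0 = 0"
    and conj: "h oo fps_of_poly (monom lam 1 + monom a (n + 1)) = fps_const lam * h"
  shows "lam * (1 - lam ^ (k * n)) * fps_nth h (k * n + 1) =
    (\<Sum>l<k. fps_nth h (l * n + 1) * of_nat ((l * n + 1) choose (k - l)) *
       lam ^ (l * n + 1 - (k - l)) * a ^ (k - l))"
proof -
  let ?f = "fps_of_poly (monom lam 1 + monom a (n + 1))"
  let ?t = "\<lambda>l. fps_nth h (l * n + 1) * of_nat ((l * n + 1) choose (k - l)) *
       lam ^ (l * n + 1 - (k - l)) * a ^ (k - l)"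
  have inj: "inj_on (\<lambda>l. l * n + 1) {..k}"
    using n by (auto intro: inj_onI)
  have "lam * fps_nth h (k * n + 1) = fps_nth (h oo ?f) (k * n + 1)"
    unfolding conj by simp
  also have "\<dots> = (\<Sum>i=0..k * n + 1. fps_nth h i * fps_nth (?f ^ i) (k * n + 1))"
    by (simp add: fps_compose_nth)
  \<comment> \<open>The \<open>i\<close>-th power of the binomial only has exponents i + jn, so the
    coefficients of \<open>h\<close> at exponents kn + 1 satisfy a closed system.\<close>
  also have "\<dots> = (\<Sum>i\<in>(\<lambda>l. l * n + 1) ` {..k}. fps_nth h i * fps_nth (?f ^ i) (k * n + 1))"
  proof (rule sum.mono_neutral_right)
    show "\<forall>i\<in>{0..k * n + 1} - (\<lambda>l. l * n + 1) ` {..k}. fps_nth h i * fps_nth (?f ^ i) (k * n + 1) = 0"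
    proof
      fix i assume i: "i \<in> {0..k * n + 1} - (\<lambda>l. l * n + 1) ` {..k}"
      show "fps_nth h i * fps_nth (?f ^ i) (k * n + 1) = 0"
      proof (cases "i = 0")
        case False
        have "k * n + 1 \<noteq> i + j * n" for j
        proof
          assume eq: "k * n + 1 = i + j * n"
          then have "j * n \<le> k * n"
            using False by linarith
          then have "j \<le> k"
            using n by simp
          then have "i = (k - j) * n + 1"
            using eq \<open>j * n \<le> k * n\<close> unfolding diff_mult_distrib by linarith
          then show False
            using i by auto
        qed
        then show ?thesis
          by (simp only: fps_nth_binomial_power[OF n] if_False sum.neutral_const mult_zero_right)
      qed (simp add: h0)
    qed
  qed (use n in auto)
  also have "\<dots> = (\<Sum>l\<le>k. ?t l)"
    unfolding sum.reindex[OF inj] o_def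
    by (rule sum.cong[OF refl], subst fps_nth_binomial_power_progression[OF n]) (simp_all add: mult_ac)
  also have "{..k} = insert k {..<k}"
    by auto
  finally show ?thesis
    by (simp add: algebra_simps)
qed

text \<open>This makes the step of length 2 across an index with p | kn + 1 available. Twice the
  binomial coefficient is (ln + 1)ln; a prime dividing either factor would, by the last hypothesis,
  divide 1 or n + 1.\<close>

lemma not_dvd_choose_two:
  fixes p l n :: nat
  assumes "prime p" "\<not> p dvd n + 1" "p dvd Suc l * n + 1"
  shows "\<not> p dvd (l * n + 1) choose 2"
proof
  assume "p dvd (l * n + 1) choose 2"
  then have "p dvd 2 * ((l * n + 1) choose 2)"
    by simp
  also have "2 * ((l * n + 1) choose 2) = (l * n + 1) * (l * n)"
    by (simp add: choose_two)
  finally consider "p dvd l * n + 1" | "p dvd l * n"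
    using assms(1) prime_dvd_mult_iff by blast
  then show False
  proof cases
    case 1
    have "Suc l * n + 1 = (l * n + 1) + n"
      by simp
    then have "p dvd n"
      using 1 assms(3) by (metis dvd_add_right_iff)
    then have "p dvd Suc l * n"
      by simp
    then have "p dvd 1"
      using assms(3) by (metis dvd_add_right_iff)
    then show False
      using assms(1) not_prime_unit by blast
  next
    case 2
    have "Suc l * n + 1 = l * n + (n + 1)"
      by simp
    then show False
      using 2 assms(2,3) by (metis dvd_add_right_iff)
  qed
qed

text \<open>From j C(N,j) = N C(N-1,j-1), where \<open>p\<close> does not divide \<open>j\<close>.
  It kills all steps shorter than \<open>p\<close> out of an index with p | kn + 1.\<close>

lemma dvd_choose_if_dvd:
  fixes p N j :: nat
  assumes "prime p" "p dvd N" "0 < j" "j < p"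
  shows "p dvd N choose j"
proof (cases "N = 0")
  case False
  have "p dvd j * (N choose j)"
    using times_binomial_minus1_eq[of j N] assms(2,3) by simp
  moreover have "\<not> p dvd j"
    using assms(3,4) by (auto dest: dvd_imp_le)
  ultimately show ?thesis
    using assms(1) prime_dvd_mult_iff by blast
qed (use assms(3) in \<open>simp add: binomial_eq_0\<close>)

section \<open>The exact absolute values of the normalized coefficients\<close>

locale resonant_recurrence = complete_nonarch_field v
  for v :: "'a::field \<Rightarrow> real" +
  fixes p n :: nat and lam :: 'a and b :: "nat \<Rightarrow> 'a"
  assumes prime: "prime p"
    and char: "CHAR('a) = p"
    and n: "n \<ge> 1"
    and not_dvd: "\<not> p dvd n + 1"
    and nonroot: "\<forall>k\<ge>1. lam ^ k \<noteq> 1"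
    and near: "v (1 - lam) < 1"
    and b_0: "b 0 = 1"
    and b_rec: "lam * (1 - lam ^ (k * n)) * b k =
      (\<Sum>l<k. b l * of_nat ((l * n + 1) choose (k - l)) * lam ^ (l * n + 1 - (k - l)))"
begin

definition skipped :: "nat \<Rightarrow> bool" where
  "skipped k \<longleftrightarrow> p dvd k * n + 1"

text \<open>For \<open>k\<close> not skipped, this is the absolute value of the weight of the path
  to \<open>k\<close> through all non-skipped indices; its binomial coefficients have absolute value
  1.\<close>

definition growth :: "nat \<Rightarrow> real" where
  "growth k = (\<Prod>j\<in>{j\<in>{1..k}. \<not> skipped j}. 1 / v (1 - lam ^ (j * n)))"

lemma v_lam: "v lam = 1"
  using near by (rule v_eq_1_if_near_1)

lemma divisor_pos: "1 \<le> k \<Longrightarrow> 0 < v (1 - lam ^ (k * n))"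
  using nonroot n by (simp add: v_pos_iff)

lemma delta_pos: "0 < v (1 - lam)"
  using nonroot[rule_format, of 1] by (simp add: v_pos_iff)

lemma divisor_le: "v (1 - lam ^ k) \<le> v (1 - lam)"
  using near by (rule v_one_minus_power_le)

lemma divisor_power_p: "v (1 - x ^ p) = v (1 - x) ^ p"
  using v_one_minus_power_CHAR prime char by simp

lemma divisor_mult_p: "v (1 - lam ^ (i * p * n)) = v (1 - lam ^ (i * n)) ^ p"
  using divisor_power_p[of "lam ^ (i * n)"] by (simp add: mult_ac flip: power_mult)

lemma growth_0 [simp]: "growth 0 = 1"
  by (simp add: growth_def)

lemma growth_Suc:
  "growth (Suc k) = (if skipped (Suc k) then growth k else growth k / v (1 - lam ^ (Suc k * n)))"
proof -
  have "{j\<in>{1..Suc k}. \<not> skipped j} =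
    (if skipped (Suc k) then {j\<in>{1..k}. \<not> skipped j} else insert (Suc k) {j\<in>{1..k}. \<not> skipped j})"
    by (auto simp: le_Suc_eq)
  then show ?thesis
    by (simp add: growth_def)
qed

lemma growth_pos: "0 < growth k"
  unfolding growth_def using divisor_pos by (intro prod_pos) simp

lemma growth_Suc_ge: "\<not> skipped (Suc k) \<Longrightarrow> growth k / v (1 - lam) \<le> growth (Suc k)"
  using growth_pos[of k] divisor_pos[of "Suc k"] divisor_le[of "Suc k * n"]
  by (simp add: growth_Suc frac_le del: mult_Suc)

lemma growth_mono: "l \<le> k \<Longrightarrow> growth l \<le> growth k"
proof (rule lift_Suc_mono_le[of growth])
  fix k
  show "growth k \<le> growth (Suc k)"
  proof (cases "skipped (Suc k)")
    case False
    have "growth k \<le> growth k / v (1 - lam)"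
      using growth_pos[of k] delta_pos near by (simp add: field_simps mult_left_le)
    then show ?thesis
      using growth_Suc_ge[OF False] by simp
  qed (simp add: growth_Suc)
qed

lemma growth_less:
  assumes "l < k" "\<not> skipped k"
  shows "growth l < growth k"
proof -
  obtain m where m: "k = Suc m" "l \<le> m"
    using assms(1) by (cases k) auto
  have "growth l \<le> growth m"
    using m by (simp add: growth_mono)
  also have "\<dots> < growth m / v (1 - lam)"
    using growth_pos[of m] delta_pos near by (simp add: field_simps)
  also have "\<dots> \<le> growth k"
    using assms(2) growth_Suc_ge m by simp
  finally show ?thesis .
qed

lemma skipped_imp:
  assumes "skipped k"
  shows "\<not> p dvd n" "3 \<le> p" "\<not> p dvd k" "1 \<le> k"
proof -
  show 1: "\<not> p dvd n"
  proof
    assume "p dvd n"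
    then have "p dvd k * n"
      by simp
    then have "p dvd 1"
      using assms unfolding skipped_def by (metis dvd_add_right_iff)
    then show False
      using prime not_prime_unit by blast
  qed
  show "\<not> p dvd k"
  proof
    assume "p dvd k"
    then have "p dvd k * n"
      by simp
    then have "p dvd 1"
      using assms unfolding skipped_def by (metis dvd_add_right_iff)
    then show False
      using prime not_prime_unit by blast
  qed
  then show "1 \<le> k"
    by (cases k) auto
  \<comment> \<open>If \<open>p\<close> were 2, then \<open>n\<close> would be odd and
    \<open>p\<close> would divide n + 1.\<close>
  have "p \<noteq> 2"
    using 1 not_dvd by auto
  then show "3 \<le> p"
    using prime_ge_2_nat[OF prime] by simp
qed

text \<open>Here \<open>n\<close> is invertible modulo \<open>p\<close>, so the skipped indices form
  a single residue class.\<close>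

lemma skipped_add:
  assumes "skipped l"
  shows "skipped (l + j) \<longleftrightarrow> p dvd j"
proof -
  have "(l + j) * n + 1 = (l * n + 1) + j * n"
    by (simp add: algebra_simps)
  then have "skipped (l + j) \<longleftrightarrow> p dvd j * n"
    using assms unfolding skipped_def by (metis dvd_add_right_iff)
  then show ?thesis
    using prime skipped_imp(1)[OF assms] prime_dvd_mult_iff by blast
qed

text \<open>The left side will be the absolute value of \<open>b l\<close>. Since p >= 3, neither l
  + 1 nor l + 2 is skipped; the first already makes up the factor 1/|1 - \<lambda>| and the second
  makes the inequality strict.\<close>

lemma growth_after_skipped:
  assumes "skipped l" "l + 2 \<le> k"
  shows "growth l / v (1 - lam) < growth k"
proof -
  have p: "3 \<le> p"
    using assms(1) by (rule skipped_imp)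
  have "\<not> skipped (l + 1)" "\<not> skipped (l + 2)"
    unfolding skipped_add[OF assms(1)] using p by (auto dest: dvd_imp_le)
  then have "growth l / v (1 - lam) \<le> growth (l + 1)" "growth (l + 1) < growth (l + 2)"
    using growth_Suc_ge[of l] growth_less[of "l + 1" "l + 2"] by simp_all
  then show ?thesis
    using growth_mono[OF assms(2)] by linarith
qed

text \<open>
  If \<open>k - 1\<close> is skipped, the step from \<open>k - 1\<close> to \<open>k\<close> has a vanishing binomial coefficient and the
  step from \<open>k - 2\<close> takes over; visiting a skipped index is never worthwhile, since the next
  admissible index is at least \<open>p\<close> further on.
\<close>

lemma v_b: "v (b k) = (if skipped k then growth k / v (1 - lam) else growth k)"
proof (induction k rule: less_induct)
  case (less k)
  show ?case
  proof (cases k)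
    case 0
    then show ?thesis
      using skipped_imp(4)[of 0] by (auto simp: b_0 v_1)
  next
    case (Suc k')
    define t where
      "t = (\<lambda>l. b l * of_nat ((l * n + 1) choose (k - l)) * lam ^ (l * n + 1 - (k - l)))"
    have v_t: "v (t l) = v (b l) * v (of_nat ((l * n + 1) choose (k - l)) :: 'a)" for l
      by (simp add: t_def v_mult v_power v_lam)
    have v_t_le: "v (t l) \<le> v (b l)" for l
      using v_of_nat_le v_nonneg by (simp add: v_t mult_left_le)
    have t_skipped: "t l = 0" if "skipped l" "l < k" "k < l + p" for l
    proof -
      have "p dvd (l * n + 1) choose (k - l)"
        using that prime by (intro dvd_choose_if_dvd) (auto simp: skipped_def)
      then have "of_nat ((l * n + 1) choose (k - l)) = (0 :: 'a)"
        using of_nat_eq_0_iff_char_dvd char by blast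
      then show ?thesis
        by (simp add: t_def)
    qed
    \<comment> \<open>The predecessor of \<open>k\<close> on the dominant path.\<close>
    define m where "m = (if skipped k' then k' - 1 else k')"
    have m: "m < k" "\<not> skipped m" "growth m = growth k'" "v (t m) = growth m"
      and m_Suc: "m = k' \<or> skipped k' \<and> k' = Suc m"
    proof -
      show "m < k"
        using Suc by (auto simp: m_def)
      have "\<not> skipped m \<and> growth m = growth k' \<and> (m = k' \<or> skipped k' \<and> k' = Suc m) \<and>
        \<not> p dvd (m * n + 1) choose (k - m)"
      proof (cases "skipped k'")
        case True
        then have k': "k' = Suc m"
          using skipped_imp(4)[OF True] by (simp add: m_def)
        have "\<not> skipped m"
        proof
          assume "skipped m"
          then have "p dvd 1"
            using skipped_add[of m 1] True k' by simp
          then show False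
            using prime not_prime_unit by blast
        qed
        moreover have "\<not> p dvd (m * n + 1) choose 2"
          using not_dvd_choose_two[OF prime not_dvd] True k' by (simp add: skipped_def)
        moreover have "k - m = 2"
          using Suc k' by simp
        ultimately show ?thesis
          using True k' growth_Suc[of m] by simp
      next
        case False
        then show ?thesis
          using Suc by (simp add: m_def skipped_def)
      qed
      note * = this
      then show "\<not> skipped m" "growth m = growth k'" "m = k' \<or> skipped k' \<and> k' = Suc m"
        by auto
      show "v (t m) = growth m"
        using * less.IH[OF \<open>m < k\<close>] v_of_nat_eq_1 prime char by (simp add: v_t)
    qed
    have dominated: "v (t l) < v (t m)" if l: "l < k" "l \<noteq> m" for l
    proof (cases "skipped l")
      case True
      show ?thesis
      proof (cases "k < l + p")
        case True
        then show ?thesis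
          using t_skipped[OF \<open>skipped l\<close> l(1)] m(4) growth_pos[of m] by (simp add: v_0)
      next
        case False
        \<comment> \<open>A nonzero step out of a skipped index has length at least p >= 3. If
          \<open>k'\<close> is skipped too, it lies at least \<open>p\<close> beyond
          \<open>l\<close>, so stepping back to \<open>m\<close> still leaves distance 2.\<close>
        have "l + 2 \<le> m"
        proof (cases "m = k'")
          case True
          then show ?thesis
            using False Suc skipped_imp(2)[OF \<open>skipped l\<close>] by simp
        next
          case k': False
          then have "skipped k'" "k' = Suc m"
            using m_Suc by auto
          then have "p dvd k' - l"
            using skipped_add[OF \<open>skipped l\<close>, of "k' - l"] l Suc by simp
          moreover have "0 < k' - l"
            using False Suc skipped_imp(2)[OF \<open>skipped l\<close>] by simp
          ultimately have "p \<le> k' - l"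
            by (simp add: dvd_imp_le)
          then show ?thesis
            using \<open>k' = Suc m\<close> skipped_imp(2)[OF \<open>skipped l\<close>] by simp
        qed
        then have "growth l / v (1 - lam) < growth m"
          by (rule growth_after_skipped[OF \<open>skipped l\<close>])
        then show ?thesis
          using v_t_le[of l] less.IH[OF l(1)] True m(4) by simp
      qed
    next
      case False
      then have "l \<noteq> k'" if "skipped k'"
        using that by blast
      then have "l < m"
        using l m_Suc Suc by (auto simp: less_Suc_eq)
      then have "growth l < growth m"
        using m(2) by (rule growth_less)
      then show ?thesis
        using v_t_le[of l] less.IH[OF l(1)] False m(4) by simp
    qed
    have "v (sum t {..<k}) = v (t m)"
      using m dominated growth_pos[of m] by (intro v_sum_eq) (auto simp: v_0)
    moreover have "lam * (1 - lam ^ (k * n)) * b k = sum t {..<k}"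
      unfolding t_def by (rule b_rec)
    ultimately have "v (1 - lam ^ (k * n)) * v (b k) = growth k'"
      using m by (metis v_mult v_lam mult_1)
    moreover have "0 < v (1 - lam ^ (k * n))"
      using divisor_pos[of k] Suc by simp
    ultimately have v_bk: "v (b k) = growth k' / v (1 - lam ^ (k * n))"
      by (simp add: field_simps)
    show ?thesis
    proof (cases "skipped k")
      case True
      \<comment> \<open>A skipped endpoint still divides by its own divisor, of absolute value |1 -
        \<lambda>|, which \<open>growth\<close> does not count; hence the extra factor.\<close>
      then have "\<not> p dvd k * n"
        using skipped_imp[OF True] prime prime_dvd_mult_iff by blast
      then have "v (1 - lam ^ (k * n)) = v (1 - lam)"
        using prime near char by (simp add: v_one_minus_power_eq)
      then show ?thesis
        using v_bk True Suc growth_Suc[of k'] by simp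
    next
      case False
      then show ?thesis
        using v_bk Suc growth_Suc[of k'] by simp
    qed
  qed
qed

section \<open>Superexponential growth along the indices p^S\<close>

lemma divisor_prod_le:
  "(\<Prod>i\<in>{1..p ^ S}. v (1 - lam ^ (i * n))) ^ p \<le> v (1 - lam) ^ (S * p ^ S)"
proof (induction S)
  case 0
  show ?case
    using divisor_le[of n] near by (simp add: power_le_one v_nonneg)
next
  case (Suc S)
  let ?d = "v (1 - lam)" and ?g = "\<lambda>i. v (1 - lam ^ (i * n))"
  let ?M = "(\<lambda>i. i * p) ` {1..p ^ S}"
  have p: "2 \<le> p"
    using prime by (rule prime_ge_2_nat)
  have sub: "?M \<subseteq> {1..p ^ Suc S}"
    using p by (auto simp: mult.commute)
  have inj: "inj_on (\<lambda>i. i * p) {1..p ^ S}"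
    using p by (auto intro: inj_onI)
  \<comment> \<open>The multiples of \<open>p\<close> reproduce the previous product to the power
    \<open>p\<close>; the other indices, at least \<open>p ^ S\<close> of them, each contribute at
    most |1 - \<lambda>|. So each level adds one more |1 - \<lambda>| per index counted by
    \<open>p ^ S\<close>.\<close>
  have "prod ?g ?M = (\<Prod>i\<in>{1..p ^ S}. ?g i) ^ p"
    unfolding prod.reindex[OF inj] by (simp add: divisor_mult_p prod_power_distrib)
  moreover have "prod ?g ({1..p ^ Suc S} - ?M) \<le> ?d ^ p ^ S"
  proof -
    have "prod ?g ({1..p ^ Suc S} - ?M) \<le> (\<Prod>i\<in>{1..p ^ Suc S} - ?M. ?d)"
      by (intro prod_mono) (simp add: divisor_le v_nonneg)
    also have "\<dots> = ?d ^ (p ^ Suc S - p ^ S)"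
      using sub inj by (simp add: card_Diff_subset card_image)
    also have "\<dots> \<le> ?d ^ p ^ S"
    proof (rule power_decreasing)
      have "2 * p ^ S \<le> p ^ Suc S"
        using p by simp
      then show "p ^ S \<le> p ^ Suc S - p ^ S"
        by linarith
    qed (use near v_nonneg in auto)
    finally show ?thesis .
  qed
  ultimately have "prod ?g {1..p ^ Suc S} \<le> ?d ^ p ^ S * (\<Prod>i\<in>{1..p ^ S}. ?g i) ^ p"
    using prod.subset_diff[OF sub, of ?g] by (simp add: mult_right_mono prod_nonneg v_nonneg)
  also have "\<dots> \<le> ?d ^ p ^ S * ?d ^ (S * p ^ S)"
    using Suc.IH by (simp add: mult_left_mono v_nonneg)
  also have "\<dots> = ?d ^ (Suc S * p ^ S)"
    by (simp flip: power_add)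
  finally have "prod ?g {1..p ^ Suc S} ^ p \<le> (?d ^ (Suc S * p ^ S)) ^ p"
    by (intro power_mono prod_nonneg) (simp_all add: v_nonneg)
  then show ?case
    by (simp add: mult_ac flip: power_mult)
qed

text \<open>Multiples of \<open>p\<close> are never skipped, and all factors of
  \<open>growth\<close> are at least 1, so only the factors at multiples of \<open>p\<close> are
  kept.\<close>

lemma v_b_ge: "(1 / v (1 - lam)) ^ (S * p ^ S) \<le> v (b (p ^ Suc S))"
proof -
  let ?g = "\<lambda>i. 1 / v (1 - lam ^ (i * n))"
  let ?M = "(\<lambda>i. i * p) ` {1..p ^ S}"
  have p: "2 \<le> p"
    using prime by (rule prime_ge_2_nat)
  have inj: "inj_on (\<lambda>i. i * p) {1..p ^ S}"
    using p by (auto intro: inj_onI)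
  have "(1 / v (1 - lam)) ^ (S * p ^ S) = 1 / v (1 - lam) ^ (S * p ^ S)"
    by (simp add: power_divide)
  also have "\<dots> \<le> 1 / (\<Prod>i\<in>{1..p ^ S}. v (1 - lam ^ (i * n))) ^ p"
    using delta_pos divisor_pos
    by (intro divide_left_mono divisor_prod_le mult_pos_pos zero_less_power prod_pos) simp_all
  also have "\<dots> = (\<Prod>i\<in>{1..p ^ S}. ?g i) ^ p"
    by (simp add: prod_dividef power_divide)
  also have "\<dots> = prod ?g ?M"
    unfolding prod.reindex[OF inj] by (simp add: divisor_mult_p power_divide prod_power_distrib)
  also have "\<dots> \<le> growth (p ^ Suc S)"
    unfolding growth_def
  proof (rule prod_mono2)
    show "?M \<subseteq> {j\<in>{1..p ^ Suc S}. \<not> skipped j}"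
      using p by (auto simp: mult.commute[of _ p] dest: skipped_imp(3))
  next
    fix i assume "i \<in> {j\<in>{1..p ^ Suc S}. \<not> skipped j} - ?M"
    then show "1 \<le> ?g i"
      using divisor_pos[of i] divisor_le[of "i * n"] near by simp
  qed (simp_all add: v_nonneg)
  also have "\<dots> = v (b (p ^ Suc S))"
    using skipped_imp(3)[of "p ^ Suc S"] v_b by auto
  finally show ?thesis .
qed

lemma not_geometrically_bounded:
  assumes "0 \<le> C" "0 \<le> R"
  shows "\<exists>k. C * R ^ k < v (b k)"
proof (rule ccontr)
  assume "\<not> ?thesis"
  then have bound: "v (b k) \<le> C * R ^ k" for k
    by (simp add: not_less)
  \<comment> \<open>Taking roots of order \<open>p ^ S\<close> leaves a bound independent of
    \<open>S\<close> for unbounded powers; \<open>max 1 C\<close> ensures that the root of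
    \<open>C\<close> stays bounded.\<close>
  have "(1 / v (1 - lam)) ^ S \<le> max 1 C * R ^ p" for S
  proof (rule power_le_imp_le_base)
    have pS: "1 \<le> p ^ S"
      using prime_gt_0_nat[OF prime] by simp
    have "((1 / v (1 - lam)) ^ S) ^ p ^ S \<le> C * R ^ p ^ Suc S"
      using v_b_ge[of S] bound[of "p ^ Suc S"] by (simp flip: power_mult)
    also have "C \<le> max 1 C ^ p ^ S"
      using power_increasing[OF pS, of "max 1 C"] by simp
    also have "max 1 C ^ p ^ S * R ^ p ^ Suc S = (max 1 C * R ^ p) ^ p ^ S"
      by (simp add: power_mult_distrib flip: power_mult)
    finally have "((1 / v (1 - lam)) ^ S) ^ p ^ S \<le> (max 1 C * R ^ p) ^ p ^ S"
      using assms(2) by (simp add: mult_right_mono)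
    moreover have "Suc (p ^ S - 1) = p ^ S"
      using pS by simp
    ultimately show "((1 / v (1 - lam)) ^ S) ^ Suc (p ^ S - 1) \<le> (max 1 C * R ^ p) ^ Suc (p ^ S - 1)"
      by (simp only:)
  qed (use assms in simp)
  moreover have "1 < 1 / v (1 - lam)"
    using near delta_pos by simp
  ultimately show False
    using real_arch_pow[of "1 / v (1 - lam)" "max 1 C * R ^ p"] by (metis not_less)
qed

end

section \<open>Application to the binomial\<close>

lemma (in complete_nonarch_field) locally_analytic_binomial:
  assumes "n \<ge> 1"
  shows "locally_analytic v (fps_of_poly (monom lam 1 + monom a (n + 1)))"
  unfolding locally_analytic_iff
proof (rule exI[of _ "max 1 (max (v lam) (v a))"], rule exI[of _ 1], intro conjI allI)
  show "v (fps_nth (fps_of_poly (monom lam 1 + monom a (n + 1))) k) \<le> max 1 (max (v lam) (v a)) * 1 ^ k" for k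
    using assms by (auto simp: v_0)
qed simp_all

theorem theorem1p5:
  fixes v :: "'a::field \<Rightarrow> real" and p :: nat and lam :: 'a
  assumes "prime p"
    and "complete_nonarch_field v"
    and "CHAR('a) = p"
    and "\<forall>k\<ge>1. lam ^ k \<noteq> 1"
    and "v (1 - lam) < 1"
  shows "\<forall>n\<ge>1. \<forall>a::'a.
    linearizable v (fps_of_poly (monom lam 1 + monom a (n + 1))) \<longleftrightarrow> p dvd n + 1 \<or> a = 0"
proof (intro allI impI)
  fix n :: nat and a :: 'a
  assume n: "n \<ge> 1"
  interpret complete_nonarch_field v
    by fact
  let ?f = "fps_of_poly (monom lam 1 + monom a (n + 1))"
  have f: "fps_nth ?f 0 = 0" "fps_nth ?f 1 = lam" "locally_analytic v ?f"
    using n locally_analytic_binomial by simp_all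
  show "linearizable v ?f \<longleftrightarrow> p dvd n + 1 \<or> a = 0"
  proof
    assume "p dvd n + 1 \<or> a = 0"
    then show "linearizable v ?f"
      \<comment> \<open>In both alternatives 1 is the only exponent of a nonzero term that
        \<open>p\<close> may fail to divide.\<close>
      using assms f by (intro linearizable_if_CHAR_dvd_exponents) (auto split: if_splits)
  next
    assume "linearizable v ?f"
    then obtain h where h: "fps_nth h 0 = 0" "fps_nth h 1 \<noteq> 0" "locally_analytic v h"
      and conj: "h oo ?f = fps_const lam * h"
      using linearizable_iff_semiconjugacy[OF f(1,3)] f(2) by auto
    show "p dvd n + 1 \<or> a = 0"
    proof (rule ccontr)
      assume "\<not> (p dvd n + 1 \<or> a = 0)"
      then have not_dvd: "\<not> p dvd n + 1" and a: "a \<noteq> 0"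
        by auto
      define b where "b k = fps_nth h (k * n + 1) / (fps_nth h 1 * a ^ k)" for k
      have h_b: "fps_nth h (k * n + 1) = fps_nth h 1 * a ^ k * b k" for k
        using a h(2) by (simp add: b_def)
      interpret resonant_recurrence v p n lam b
      proof
        fix k
        have "fps_nth h 1 * a ^ k * (lam * (1 - lam ^ (k * n)) * b k) =
          lam * (1 - lam ^ (k * n)) * fps_nth h (k * n + 1)"
          unfolding h_b by (simp add: mult_ac)
        also have "\<dots> = (\<Sum>l<k. fps_nth h (l * n + 1) * of_nat ((l * n + 1) choose (k - l)) *
            lam ^ (l * n + 1 - (k - l)) * a ^ (k - l))"
          by (rule semiconjugacy_coeff_recurrence[OF n h(1) conj])
        also have "\<dots> = (\<Sum>l<k. fps_nth h 1 * a ^ k *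
            (b l * of_nat ((l * n + 1) choose (k - l)) * lam ^ (l * n + 1 - (k - l))))"
        proof (rule sum.cong[OF refl])
          fix l assume "l \<in> {..<k}"
          then have "a ^ k = a ^ l * a ^ (k - l)"
            by (simp flip: power_add)
          then show "fps_nth h (l * n + 1) * of_nat ((l * n + 1) choose (k - l)) *
              lam ^ (l * n + 1 - (k - l)) * a ^ (k - l) = fps_nth h 1 * a ^ k *
              (b l * of_nat ((l * n + 1) choose (k - l)) * lam ^ (l * n + 1 - (k - l)))"
            unfolding h_b by (simp only: mult_ac)
        qed
        finally show "lam * (1 - lam ^ (k * n)) * b k =
            (\<Sum>l<k. b l * of_nat ((l * n + 1) choose (k - l)) * lam ^ (l * n + 1 - (k - l)))"
          using a h(2) by (simp flip: sum_distrib_left)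
      qed (use assms n not_dvd h(2) in \<open>simp_all add: b_def\<close>)
      obtain C R where CR: "C \<ge> 1" "R \<ge> 1" "\<And>k. v (fps_nth h k) \<le> C * R ^ k"
        using h(3) by (auto simp: locally_analytic_iff)
      \<comment> \<open>These constants come from R^(kn+1) = R (R^n)^k after dividing by the
        normalizing factor in \<open>b\<close>.\<close>
      obtain k where "C * R / v (fps_nth h 1) * (R ^ n / v a) ^ k < v (b k)"
        using not_geometrically_bounded[of "C * R / v (fps_nth h 1)" "R ^ n / v a"] CR(1,2)
        by (auto simp: v_nonneg)
      moreover have "v (b k) \<le> C * R ^ (k * n + 1) / (v (fps_nth h 1) * v a ^ k)"
        unfolding b_def v_divide v_mult v_power
        by (intro divide_right_mono CR(3)) (simp add: v_nonneg)
      ultimately show False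
        by (simp add: power_divide mult_ac flip: power_mult)
    qed
  qed
qed

end
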